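(* Let $f:\mathbb{R}\to\mathbb{C}$ be a bounded continuous function with $f(0)=1$ and \[ \int_{-\infty}^{\infty}\frac{|f(t)|}{1+|t|}\,dt<\infty . \] For $z\in\mathbb{C}\setminus\mathbb{R}$ define the Cauchy transform \[ k_f(z)=\frac{i}{\pi}\int_{-\infty}^{\infty}\frac{f(t)}{z-t}\,dt . \] Then $f$ is a characteristic function if and only if: (i) the function $y\mapsto k_f(iy)$ is completely monotonic on $(0,\infty)$, and (ii) the function $y\mapsto -k_f(iy)$ is absolutely monotonic on $(-\infty,0)$.
   Context: A function $f:\mathbb{R}\to\mathbb{C}$ is a characteristic function if there is a probability measure $\sigma$ on $\mathbb{R}$ with $f(x)=\int_{-\infty}^{\infty}e^{ixt}\,d\sigma(t)$ for all $x\in\mathbb{R}$. A function $\omega:(a,b)\to\mathbb{R}$ ($-\infty\le a<b\le\infty$) is completely monotonic if it is infinitely differentiable and $(-1)^n\omega^{(n)}(x)\ge 0$ for all $x\in(a,b)$ and all $n=0,1,2,\dots$. A function $\omega$ is absolutely monotonic on $(a,b)$ if $x\mapsto\omega(-x)$ is completely monotonic on $(-b,-a)$, equivalently $\omega$ is infinitely differentiable with $\omega^{(n)}(x)\ge0$ for all $x\in(a,b)$ and all $n\ge 0$. (In particular, conditions (i) and (ii) require the respective functions to be real-valued.) *)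

theory Defs
  imports "HOL-Probability.Probability"
begin

definition is_char_fun :: "(real \<Rightarrow> complex) \<Rightarrow> bool" where
  "is_char_fun f \<longleftrightarrow> (\<exists>M. real_distribution M \<and> (\<forall>x. f x = char M x))"

definition derivs_on :: "real set \<Rightarrow> (real \<Rightarrow> real) \<Rightarrow> (nat \<Rightarrow> real \<Rightarrow> real) \<Rightarrow> bool" where
  "derivs_on S w D \<longleftrightarrow> (\<forall>x\<in>S. D 0 x = w x) \<and>
     (\<forall>n. \<forall>x\<in>S. (D n has_real_derivative D (Suc n) x) (at x))"

definition completely_monotonic_on :: "real set \<Rightarrow> (real \<Rightarrow> real) \<Rightarrow> bool" where
  "completely_monotonic_on S w \<longleftrightarrow>
     (\<exists>D. derivs_on S w D \<and> (\<forall>n. \<forall>x\<in>S. (-1) ^ n * D n x \<ge> 0))"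

definition absolutely_monotonic_on :: "real set \<Rightarrow> (real \<Rightarrow> real) \<Rightarrow> bool" where
  "absolutely_monotonic_on S w \<longleftrightarrow>
     (\<exists>D. derivs_on S w D \<and> (\<forall>n. \<forall>x\<in>S. D n x \<ge> 0))"

definition cauchy_transform :: "(real \<Rightarrow> complex) \<Rightarrow> complex \<Rightarrow> complex" where
  "cauchy_transform f z = (\<i> / complex_of_real pi) *
      (\<integral>t. f t / (z - complex_of_real t) \<partial>lborel)"

end

theory Submission
  imports Defs "HOL-Complex_Analysis.Cauchy_Integral_Formula"
begin

text \<open>
  Put \<open>K\<^sub>n(w) = 1/\<pi> \<integral> f(t) / (w + it)\<^bsup>n+1\<^esup> dt\<close> for \<open>Re w > 0\<close>. Then \<open>k\<^sub>f(iy) = K\<^sub>0(y)\<close> for \<open>y > 0\<close>,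
  the \<open>n\<close>-th derivative of \<open>K\<^sub>0\<close> is \<open>(-1)\<^sup>n n! K\<^sub>n\<close>, and the negative half of the axis is the positive
  half for the reflected function \<open>f(-t)\<close>. So conditions (i) and (ii) say that \<open>K\<^sub>n(a) \<ge> 0\<close>
  for all \<open>n\<close> and \<open>a > 0\<close>, both for \<open>f\<close> and for its reflection.

  If \<open>f\<close> is a characteristic function, then so is its product with the function
  \<open>(a / (a + it))\<^bsup>n+1\<^esup>\<close>, the characteristic function of a reflected Erlang variable. Its integrals
  against centred Gaussian densities are nonnegative, and widening the Gaussians gives \<open>K\<^sub>n(a) \<ge> 0\<close>.

  Conversely, no representation theorem for completely monotonic functions is needed: Taylor
  expansion around \<open>N\<close> gives \<open>K\<^sub>0(N - N r e\<^bsup>is/N\<^esup>) = \<Sum>\<^sub>k K\<^sub>k(N) (N r)\<^sup>k e\<^bsup>isk/N\<^esup>\<close> for \<open>r < 1\<close>, which is the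
  Fourier transform of a finite positive measure on the points \<open>k/N\<close>. Adding the mirror image of the
  corresponding measure for the reflection of \<open>f\<close> turns the left-hand side into twice a Poisson
  integral of \<open>f\<close>, and this tends to \<open>2 f(s)\<close> as \<open>N \<rightarrow> \<infinity>\<close> with \<open>r = 1 - 1/N\<^sup>2\<close>. By Levy's
  continuity theorem the limit \<open>f\<close> is a characteristic function.
\<close>

section \<open>Levy continuity without a given limit distribution\<close>

text \<open>Parseval's identity against a Gaussian: after Fubini the inner integral is the
  characteristic function of the standard normal law. It serves twice, for tail estimates and, the
  right side being nonnegative, for the sign of the kernel integrals.\<close>

lemma char_std_normal_scaled_integral:
  assumes "real_distribution M"
  shows "(\<integral>t. char M (d * t) \<partial>std_normal_distribution) = complex_of_real (\<integral>x. exp (- (d * x)\<^sup>2 / 2) \<partial>M)"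
proof -
  interpret M: real_distribution M by fact
  interpret N: real_distribution std_normal_distribution by (rule real_dist_normal_dist)
  interpret P: pair_prob_space std_normal_distribution M ..
  have "(\<integral>t. char M (d * t) \<partial>std_normal_distribution)
      = (\<integral>t. (\<integral>x. iexp (d * t * x) \<partial>M) \<partial>std_normal_distribution)"
    by (simp add: char_def)
  also have "\<dots> = (\<integral>x. (\<integral>t. iexp (d * t * x) \<partial>std_normal_distribution) \<partial>M)"
    by (rule P.Fubini_integral[symmetric], rule P.integrable_const_bound[where B=1])
       (auto simp: case_prod_beta)
  also have "\<dots> = (\<integral>x. char std_normal_distribution (d * x) \<partial>M)"
    unfolding char_def by (intro Bochner_Integration.integral_cong refl) (simp add: mult_ac)
  also have "\<dots> = (\<integral>x. complex_of_real (exp (- (d * x)\<^sup>2 / 2)) \<partial>M)"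
    by (simp only: char_std_normal_distribution)
  finally show ?thesis by (simp only: integral_complex_of_real)
qed

text \<open>Where \<open>d * x\<close> has modulus at least 1,
  \<open>1 - exp (- (d * x)\<^sup>2 / 2)\<close> is at least 1/3, and it is nonnegative elsewhere.
  Integrating this turns closeness to 1 of a Gaussian average of \<open>char M\<close> into a tail
  estimate.\<close>

lemma real_distribution_tail_bound:
  assumes "real_distribution M" "d > 0"
  shows "measure M {x. \<bar>x\<bar> \<ge> 1 / d} / 3 \<le> 1 - Re (\<integral>t. char M (d * t) \<partial>std_normal_distribution)"
proof -
  interpret M: real_distribution M by fact
  have int: "integrable M (\<lambda>x. exp (- (d * x)\<^sup>2 / 2))"
    by (rule M.integrable_const_bound[where B=1]) auto
  have e: "exp (-(1/2)::real) \<le> 2/3"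
  proof -
    have "(3/2::real) \<le> exp (1/2)" using exp_ge_add_one_self[of "1/2::real"] by simp
    thus ?thesis by (simp add: exp_minus field_simps)
  qed
  have *: "indicator {x. \<bar>x\<bar> \<ge> 1 / d} x / 3 \<le> 1 - exp (- (d * x)\<^sup>2 / 2)" for x :: real
  proof (cases "\<bar>x\<bar> \<ge> 1 / d")
    case True
    hence "1 \<le> \<bar>d * x\<bar>" using assms(2) by (simp add: abs_mult field_simps)
    hence "1 \<le> (d * x)\<^sup>2" by (metis abs_le_square_iff abs_one power_one)
    hence "exp (- (d * x)\<^sup>2 / 2) \<le> exp (-(1/2))" by simp
    also note e
    finally show ?thesis using True by simp
  qed auto
  have "(\<integral>x. indicator {x. \<bar>x\<bar> \<ge> 1 / d} x / 3 \<partial>M) \<le> (\<integral>x. 1 - exp (- (d * x)\<^sup>2 / 2) \<partial>M)"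
    using int by (intro integral_mono *) (auto intro!: integrable_real_indicator simp: M.emeasure_eq_measure)
  also have "\<dots> = 1 - (\<integral>x. exp (- (d * x)\<^sup>2 / 2) \<partial>M)"
    using int M.prob_space by simp
  finally show ?thesis
    by (simp add: char_std_normal_scaled_integral[OF assms(1)])
qed

text \<open>Continuity from above gives every single measure a small tail. Only finitely many
  indices precede the eventual bound, so the maximum of their thresholds and the common one works
  for all.\<close>

lemma tight_if_eventually_concentrated:
  assumes rd: "\<And>n. real_distribution (M n)"
    and ev: "\<And>e. e > 0 \<Longrightarrow> \<exists>K. eventually (\<lambda>n. measure (M n) {x. \<bar>x\<bar> \<ge> K} < e) sequentially"
  shows "tight M"
  unfolding tight_def
proof (intro conjI allI impI rd)
  fix e :: real assume e: "e > 0"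
  interpret M: real_distribution "M n" for n by (rule rd)
  have tail: "\<exists>K. measure (M n) {x. \<bar>x\<bar> \<ge> K} < e" for n
  proof -
    have "(\<lambda>k. measure (M n) {x. \<bar>x\<bar> \<ge> real k}) \<longlonglongrightarrow> measure (M n) (\<Inter>k. {x. \<bar>x\<bar> \<ge> real k})"
      by (rule M.finite_Lim_measure_decseq) (auto simp: decseq_def)
    also have "(\<Inter>k. {x::real. \<bar>x\<bar> \<ge> real k}) = {}"
      by (auto simp: set_eq_iff not_le intro: reals_Archimedean2)
    finally have "eventually (\<lambda>k. measure (M n) {x. \<bar>x\<bar> \<ge> real k} < e) sequentially"
      using e by (auto simp: order_tendsto_iff)
    thus ?thesis by (auto simp: eventually_sequentially)
  qed
  then obtain k where k: "\<And>n. measure (M n) {x. \<bar>x\<bar> \<ge> k n} < e" by metis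
  obtain K N where K: "\<And>n. n \<ge> N \<Longrightarrow> measure (M n) {x. \<bar>x\<bar> \<ge> K} < e"
    using ev[OF e] by (auto simp: eventually_sequentially)
  \<comment> \<open>The entry 1 keeps \<open>L\<close> positive, so that the interval from
    \<open>-L\<close> to \<open>L\<close> required by tightness is nondegenerate.\<close>
  define L where "L = Max (insert 1 (insert K (k ` {..<N})))"
  have L: "measure (M n) {x. \<bar>x\<bar> \<ge> L} < e" for n
  proof -
    have "k n \<le> L" if "n < N"
      unfolding L_def by (rule Max_ge) (use that in auto)
    moreover have "K \<le> L"
      unfolding L_def by (rule Max_ge) auto
    ultimately obtain K' where "measure (M n) {x. \<bar>x\<bar> \<ge> K'} < e" "K' \<le> L"
      using k[of n] K[of n] by (cases "n < N") (blast, simp)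
    moreover have "measure (M n) {x. \<bar>x\<bar> \<ge> L} \<le> measure (M n) {x. \<bar>x\<bar> \<ge> K'}"
      using \<open>K' \<le> L\<close> by (intro M.finite_measure_mono) auto
    ultimately show ?thesis by linarith
  qed
  have "L \<ge> 1" unfolding L_def by (rule Max_ge) auto
  have "1 - e < measure (M n) {-L<..L}" for n
  proof -
    have "1 - measure (M n) {-L<..L} = measure (M n) (UNIV - {-L<..L})"
      using M.prob_compl[of "{-L<..L}" n] by simp
    also have "\<dots> \<le> measure (M n) {x. \<bar>x\<bar> \<ge> L}"
      by (intro M.finite_measure_mono) auto
    finally show ?thesis using L[of n] by linarith
  qed
  thus "\<exists>a b. a < b \<and> (\<forall>n. 1 - e < measure (M n) {a<..b})"
    using \<open>L \<ge> 1\<close> by (intro exI[of _ "-L"] exI[of _ L]) auto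
qed

text \<open>Continuity of \<open>f\<close> at 0 brings its Gaussian averages at small scale close to
  1. At a fixed scale these are limits of the averages of \<open>char (M n)\<close>, so the tail
  bound gives tightness.\<close>

theorem levy_continuity_isCont:
  fixes M :: "nat \<Rightarrow> real measure" and f :: "real \<Rightarrow> complex"
  assumes rd: "\<And>n. real_distribution (M n)"
    and lim: "\<And>t. (\<lambda>n. char (M n) t) \<longlonglongrightarrow> f t"
    and cont: "isCont f 0"
  obtains M' where "real_distribution M'" "f = char M'"
proof -
  interpret M: real_distribution "M n" for n by (rule rd)
  interpret N: real_distribution std_normal_distribution by (rule real_dist_normal_dist)
  have [measurable]: "f \<in> borel_measurable borel"
    by (rule borel_measurable_LIMSEQ_metric[OF _ lim]) simp
  have bound: "norm (f t) \<le> 1" for t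
    by (rule LIMSEQ_le_const2[OF tendsto_norm[OF lim]]) (auto simp: M.cmod_char_le_1)
  have f0: "f 0 = 1"
    using LIMSEQ_unique[OF lim[of 0]] by (simp add: M.char_zero)
  have lim1: "(\<lambda>n. \<integral>t. char (M n) (d * t) \<partial>std_normal_distribution)
      \<longlonglongrightarrow> (\<integral>t. f (d * t) \<partial>std_normal_distribution)" for d
    by (rule integral_dominated_convergence[where w="\<lambda>_. 1"]) (auto simp: lim M.cmod_char_le_1)
  have lim2: "(\<lambda>n. \<integral>t. f (1 / Suc n * t) \<partial>std_normal_distribution)
      \<longlonglongrightarrow> (\<integral>t. 1 \<partial>std_normal_distribution)"
  proof (rule integral_dominated_convergence[where w="\<lambda>_. 1"])
    have "(\<lambda>n. f (1 / real (Suc n) * t)) \<longlonglongrightarrow> f 0" for t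
      by (rule isCont_tendsto_compose[OF cont])
         (rule tendsto_mult_left_zero[OF LIMSEQ_inverse_real_of_nat[unfolded inverse_eq_divide]])
    hence "(\<lambda>n. f (1 / real (Suc n) * t)) \<longlonglongrightarrow> 1" for t
      unfolding f0 .
    thus "AE t in std_normal_distribution. (\<lambda>n. f (1 / Suc n * t)) \<longlonglongrightarrow> 1" by simp
  qed (auto simp: bound)
  have "tight M"
  proof (rule tight_if_eventually_concentrated[OF rd])
    fix e :: real assume e: "e > 0"
    have "(\<lambda>n. 1 - Re (\<integral>t. f (1 / Suc n * t) \<partial>std_normal_distribution)) \<longlonglongrightarrow> 1 - Re 1"
      using lim2 N.prob_space by (intro tendsto_intros) simp
    hence "eventually (\<lambda>n. 1 - Re (\<integral>t. f (1 / Suc n * t) \<partial>std_normal_distribution) < e / 3) sequentially"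
      by (rule order_tendstoD(2)) (use e in simp)
    then obtain n where n: "1 - Re (\<integral>t. f (1 / Suc n * t) \<partial>std_normal_distribution) < e / 3"
      by (auto simp only: eventually_sequentially)
    define d where "d = 1 / real (Suc n)"
    have d: "d > 0" and "1 - Re (\<integral>t. f (d * t) \<partial>std_normal_distribution) < e / 3"
      using n by (simp_all only: d_def) simp
    have "(\<lambda>n. 1 - Re (\<integral>t. char (M n) (d * t) \<partial>std_normal_distribution))
        \<longlonglongrightarrow> 1 - Re (\<integral>t. f (d * t) \<partial>std_normal_distribution)"
      by (intro tendsto_intros lim1)
    hence "eventually (\<lambda>n. 1 - Re (\<integral>t. char (M n) (d * t) \<partial>std_normal_distribution) < e / 3) sequentially"
      by (rule order_tendstoD(2)) fact
    hence "eventually (\<lambda>n. measure (M n) {x. \<bar>x\<bar> \<ge> 1 / d} < e) sequentially"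
    proof eventually_elim
      case (elim n)
      thus ?case using real_distribution_tail_bound[OF rd d, of n] by simp
    qed
    thus "\<exists>K. eventually (\<lambda>n. measure (M n) {x. \<bar>x\<bar> \<ge> K} < e) sequentially" by blast
  qed
  \<comment> \<open>Tightness provides a weak limit along a subsequence; its characteristic function
    is \<open>f\<close>, because \<open>char (M n)\<close> converges to \<open>f\<close> along the
    full sequence.\<close>
  from tight_imp_convergent_subsubsequence[OF this strict_mono_id]
  obtain r M' where r: "strict_mono r" "real_distribution M'" "weak_conv_m (M \<circ> id \<circ> r) M'"
    by auto
  have "f t = char M' t" for t
  proof (rule LIMSEQ_unique)
    show "(\<lambda>n. char ((M \<circ> id \<circ> r) n) t) \<longlonglongrightarrow> char M' t"
      by (intro levy_continuity1 r) (simp add: rd)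
    show "(\<lambda>n. char ((M \<circ> id \<circ> r) n) t) \<longlonglongrightarrow> f t"
      using LIMSEQ_subseq_LIMSEQ[OF lim r(1)] by (simp add: o_def)
  qed
  with r that show ?thesis by blast
qed

section \<open>Erlang and discrete distributions\<close>

text \<open>This derivative pairs \<open>n\<close> with \<open>Suc n\<close>: integrated over the
  half-line, it is the integration by parts that relates consecutive Laplace integrals.\<close>

lemma power_times_exp_has_vector_derivative:
  "((\<lambda>x. complex_of_real (x ^ Suc n / fact (Suc n)) * exp (- (c * complex_of_real x))) has_vector_derivative
    complex_of_real (x ^ n / fact n) * exp (- (c * complex_of_real x))
    - c * (complex_of_real (x ^ Suc n / fact (Suc n)) * exp (- (c * complex_of_real x)))) (at x)"
proof -
  have "((\<lambda>x::real. x ^ Suc n / fact (Suc n)) has_real_derivative x ^ n / fact n) (at x)"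
    using DERIV_cdivide[OF DERIV_pow[of "Suc n" x], of "fact (Suc n)"]
    by (simp add: fact_Suc del: of_nat_Suc)
  hence 1: "((\<lambda>x. complex_of_real (x ^ Suc n / fact (Suc n))) has_vector_derivative complex_of_real (x ^ n / fact n)) (at x)"
    by (intro has_vector_derivative_of_real) (simp add: has_real_derivative_iff_has_vector_derivative)
  have "((\<lambda>z. exp (- (c * z))) has_field_derivative - c * exp (- (c * complex_of_real x))) (at (complex_of_real x))"
    by (auto intro!: derivative_eq_intros)
  hence 2: "((\<lambda>x. exp (- (c * complex_of_real x))) has_vector_derivative - c * exp (- (c * complex_of_real x))) (at x)"
    by (rule has_vector_derivative_real_field)
  show ?thesis
    using has_vector_derivative_mult[OF 1 2] by (simp add: algebra_simps)
qed

lemma integrable_erlang_density: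
  assumes "a > 0"
  shows "integrable lborel (erlang_density n a)"
proof (rule integrableI_nonneg)
  show "(\<integral>\<^sup>+ x. ennreal (erlang_density n a x) \<partial>lborel) < \<infinity>"
    using nn_integral_erlang_ith_moment[OF assms, of n 0] by simp
qed (use assms in auto)

text \<open>Induction on \<open>n\<close> by integration by parts, for complex \<open>c\<close>.
  Integrability is read off from the modulus, which on the half-line is a constant multiple of the
  Erlang density of rate \<open>Re c\<close>.\<close>

lemma laplace_integral_power:
  assumes "Re c > 0"
  shows "set_integrable lborel {0<..} (\<lambda>x. complex_of_real (x ^ n / fact n) * exp (- (c * complex_of_real x)))"
    and "(LBINT x:{0<..}. complex_of_real (x ^ n / fact n) * exp (- (c * complex_of_real x))) = 1 / c ^ Suc n"
proof -
  let ?G = "\<lambda>n x. complex_of_real (x ^ n / fact n) * exp (- (c * complex_of_real x))"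
  have c: "c \<noteq> 0" using assms by auto
  have nrm: "norm (?G n x) = x ^ n / fact n * exp (- (Re c * x))" if "x \<ge> 0" for n x
    using that by (simp add: norm_mult norm_power norm_divide)
  have int: "set_integrable lborel {0<..} (?G n)" for n
    unfolding set_integrable_def
  proof (rule Bochner_Integration.integrable_bound)
    show "integrable lborel (\<lambda>x. erlang_density n (Re c) x / Re c ^ Suc n)"
      using assms by (intro integrable_divide integrable_erlang_density)
    show "AE x in lborel. norm (indicator {0<..} x *\<^sub>R ?G n x) \<le> norm (erlang_density n (Re c) x / Re c ^ Suc n)"
    proof (intro AE_I2)
      fix x :: real
      show "norm (indicator {0<..} x *\<^sub>R ?G n x) \<le> norm (erlang_density n (Re c) x / Re c ^ Suc n)"
        using nrm[of x n] assms by (cases "x > 0") (simp_all add: erlang_density_def)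
    qed
  qed measurable
  show "set_integrable lborel {0<..} (?G n)" by (rule int)
  have lim: "((\<lambda>x. ?G n x) \<longlongrightarrow> 0) at_top" for n
  proof (rule tendsto_norm_zero_cancel, rule Lim_transform_eventually)
    have "filterlim (\<lambda>x. Re c * x) at_top at_top"
      using assms by (intro filterlim_tendsto_pos_mult_at_top[OF tendsto_const] filterlim_ident)
    from filterlim_compose[OF tendsto_power_div_exp_0[of n] this]
    have "((\<lambda>x. (Re c * x) ^ n / exp (Re c * x) * (1 / (Re c ^ n * fact n))) \<longlongrightarrow> 0) at_top"
      by (rule tendsto_mult_left_zero)
    moreover have "(Re c * x) ^ n / exp (Re c * x) * (1 / (Re c ^ n * fact n)) = x ^ n / fact n * exp (- (Re c * x))" for x
      using assms by (simp add: exp_minus power_mult_distrib divide_inverse mult_ac)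
    ultimately show "((\<lambda>x. x ^ n / fact n * exp (- (Re c * x))) \<longlongrightarrow> 0) at_top"
      by simp
    show "eventually (\<lambda>x. x ^ n / fact n * exp (- (Re c * x)) = norm (?G n x)) at_top"
      using eventually_ge_at_top[of 0] by eventually_elim (use nrm in simp)
  qed
  have cont: "isCont (?G n) x" for n x
    by (intro continuous_intros) auto
  have lim0: "(?G n \<longlongrightarrow> ?G n 0) (at_right 0)" for n
    using cont[where n=n and x=0] unfolding isCont_def by (rule Lim_at_imp_Lim_at_within)
  have rec: "(LBINT x:{0<..}. F' x) = - F 0"
    if "\<And>x. (F has_vector_derivative F' x) (at x)" "\<And>x. isCont F' x"
      "set_integrable lborel {0<..} F'" "(F \<longlongrightarrow> F 0) (at_right 0)" "(F \<longlongrightarrow> 0) at_top"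
    for F F' :: "real \<Rightarrow> complex"
  proof -
    have "(LBINT x=0..\<infinity>. F' x) = 0 - F 0"
    proof (rule interval_integral_FTC_integrable)
      show "set_integrable lborel (einterval 0 \<infinity>) F'" using that(3) by (simp add: zero_ereal_def)
      show "((F \<circ> real_of_ereal) \<longlongrightarrow> F 0) (at_right 0)"
        using that(4) by (simp add: zero_ereal_def ereal_tendsto_simps)
      show "((F \<circ> real_of_ereal) \<longlongrightarrow> 0) (at_left \<infinity>)"
        using that(5) by (simp add: ereal_tendsto_simps)
    qed (use that in auto)
    thus ?thesis by (simp add: interval_lebesgue_integral_def zero_ereal_def)
  qed
  show "(LBINT x:{0<..}. ?G n x) = 1 / c ^ Suc n"
  proof (induction n)
    case 0
    have "(LBINT x:{0<..}. - c * ?G 0 x) = - ?G 0 0"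
    proof (rule rec)
      fix x :: real
      have "((\<lambda>z. exp (- (c * z))) has_field_derivative - c * exp (- (c * complex_of_real x))) (at (complex_of_real x))"
        by (auto intro!: derivative_eq_intros)
      from has_vector_derivative_real_field[OF this]
      show "(?G 0 has_vector_derivative - c * ?G 0 x) (at x)" by simp
      show "isCont (\<lambda>x. - c * ?G 0 x) x" by (intro continuous_intros) auto
      show "set_integrable lborel {0<..} (\<lambda>x. - c * ?G 0 x)"
        by (intro set_integrable_mult_right int)
    qed (use lim0[of 0] lim[of 0] in auto)
    hence "- c * (LBINT x:{0<..}. ?G 0 x) = - ?G 0 0"
      by (simp only: set_integral_mult_right)
    thus ?case using c by (simp add: field_simps)
  next
    case (Suc n)
    \<comment> \<open>Here \<open>?G (Suc n)\<close> vanishes both at 0 and at infinity, so the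
      integral for \<open>n\<close> is \<open>c\<close> times the one for
      \<open>Suc n\<close>.\<close>
    have "(LBINT x:{0<..}. ?G n x - c * ?G (Suc n) x) = - ?G (Suc n) 0"
    proof (rule rec)
      show "isCont (\<lambda>x. ?G n x - c * ?G (Suc n) x) x" for x
        by (intro isCont_diff isCont_mult cont continuous_const)
      show "set_integrable lborel {0<..} (\<lambda>x. ?G n x - c * ?G (Suc n) x)"
        by (intro set_integral_diff set_integrable_mult_right int)
    qed (rule power_times_exp_has_vector_derivative lim0 lim)+
    moreover have "(LBINT x:{0<..}. ?G n x - c * ?G (Suc n) x) = 1 / c ^ Suc n - c * (LBINT x:{0<..}. ?G (Suc n) x)"
      by (simp only: Suc.IH set_integral_mult_right set_integral_diff(2)[OF int set_integrable_mult_right[OF int]])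
    ultimately show ?case using c by (simp add: field_simps)
  qed
qed

lemma real_distribution_erlang:
  assumes "a > 0"
  shows "real_distribution (density lborel (erlang_density n a))"
proof -
  interpret prob_space "density lborel (erlang_density n a)"
    by (rule prob_space_erlang_density) (use assms in auto)
  show ?thesis by unfold_locales auto
qed

lemma char_erlang:
  assumes "a > 0"
  shows "char (density lborel (erlang_density n a)) t
    = complex_of_real (a ^ Suc n) / (complex_of_real a - \<i> * complex_of_real t) ^ Suc n"
proof -
  let ?c = "complex_of_real a - \<i> * complex_of_real t"
  let ?G = "\<lambda>x. complex_of_real (x ^ n / fact n) * exp (- (?c * complex_of_real x))"
  have "char (density lborel (erlang_density n a)) t = (\<integral>x. erlang_density n a x *\<^sub>R iexp (t * x) \<partial>lborel)"
    unfolding char_def by (subst integral_density) (use assms in auto)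
  also have "\<dots> = (\<integral>x. complex_of_real (a ^ Suc n) * (indicator {0<..} x *\<^sub>R ?G x) \<partial>lborel)"
  proof (rule integral_cong_AE)
    have "erlang_density n a x *\<^sub>R iexp (t * x) = complex_of_real (a ^ Suc n) * (indicator {0<..} x *\<^sub>R ?G x)"
      if "x \<noteq> 0" for x
    proof (cases "x > 0")
      case True
      have "exp (- (?c * complex_of_real x)) = complex_of_real (exp (- a * x)) * iexp (t * x)"
        by (simp add: exp_of_real[symmetric] mult_exp_exp algebra_simps)
      thus ?thesis using True by (simp add: erlang_density_def scaleR_conv_of_real)
    qed (use that in \<open>auto simp: erlang_density_def\<close>)
    thus "AE x in lborel. erlang_density n a x *\<^sub>R iexp (t * x) = complex_of_real (a ^ Suc n) * (indicator {0<..} x *\<^sub>R ?G x)"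
      by (intro eventually_mono[OF AE_lborel_singleton[of 0]])
  qed measurable
  also have "\<dots> = complex_of_real (a ^ Suc n) * (1 / ?c ^ Suc n)"
    using laplace_integral_power(2)[of ?c n] assms
    by (simp only: set_lebesgue_integral_def integral_mult_right_zero) simp
  finally show ?thesis by simp
qed

text \<open>The law of a difference of independent variables. Taking the difference rather than the
  sum turns the denominator \<open>a - i t\<close> of \<open>char_erlang\<close> into the
  \<open>a + i t\<close> of the kernel.\<close>

lemma char_distr_diff:
  assumes "real_distribution M" "real_distribution E"
  obtains D where "real_distribution D" "\<And>t. char D t = char M t * char E (- t)"
proof -
  interpret M: real_distribution M by fact
  interpret E: real_distribution E by fact
  interpret P: pair_prob_space M E ..
  let ?D = "distr (M \<Otimes>\<^sub>M E) borel (\<lambda>(x, y). x - y)"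
  have "real_distribution ?D"
    by (rule P.real_distribution_distr) measurable
  moreover have "char ?D t = char M t * char E (- t)" for t
  proof -
    have "char ?D t = (\<integral>z. iexp (t * (fst z - snd z)) \<partial>(M \<Otimes>\<^sub>M E))"
      unfolding char_def by (subst integral_distr) (auto simp: case_prod_beta)
    also have "\<dots> = (\<integral>x. (\<integral>y. iexp (t * (x - y)) \<partial>E) \<partial>M)"
      by (subst P.integral_fst'[symmetric]) (auto intro!: P.integrable_const_bound[where B=1])
    also have "\<dots> = (\<integral>x. (\<integral>y. iexp (t * x) * iexp (- t * y) \<partial>E) \<partial>M)"
      unfolding exp_add[symmetric] by (simp add: algebra_simps)
    also have "\<dots> = char M t * char E (- t)"
      by (simp only: integral_mult_right_zero integral_mult_left_zero char_def)
    finally show ?thesis .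
  qed
  ultimately show thesis using that by blast
qed

lemma char_distr_uminus:
  assumes "real_distribution M"
  shows "real_distribution (distr M borel uminus)" "char (distr M borel uminus) t = char M (- t)"
proof -
  interpret real_distribution M by fact
  show "real_distribution (distr M borel uminus)"
    by (rule real_distribution_distr) simp
  show "char (distr M borel uminus) t = char M (- t)"
    unfolding char_def by (subst integral_distr) simp_all
qed

text \<open>The normalised weights form a mass function on the indices, which is pushed forward
  along \<open>x\<close>. This permits repeated points, such as the 0 that two merged sequences
  share below.\<close>

lemma ex_discrete_distribution:
  fixes c x :: "nat \<Rightarrow> real"
  assumes nonneg: "\<And>j. 0 \<le> c j" and sums: "c sums T" and T: "T > 0"
  obtains M where "real_distribution M"
    "\<And>t s. (\<lambda>j. complex_of_real (c j) * iexp (t * x j)) sums s \<Longrightarrow> char M t = s / complex_of_real T"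
proof -
  define p where "p = embed_pmf (\<lambda>j. c j / T)"
  have c1: "(\<lambda>j. c j / T) sums 1"
    using sums_divide[OF sums, of T] T by simp
  have pmf_p: "pmf p j = c j / T" for j
    unfolding p_def
  proof (rule pmf_embed_pmf)
    show "(\<integral>\<^sup>+ j. ennreal (c j / T) \<partial>count_space UNIV) = 1"
      using c1 nonneg T by (simp add: nn_integral_count_space_nat suminf_ennreal2 sums_iff)
  qed (use nonneg T in simp)
  have "real_distribution (distr (measure_pmf p) borel x)"
    by (rule prob_space.real_distribution_distr[OF prob_space_measure_pmf]) simp
  moreover have "char (distr (measure_pmf p) borel x) t = s / complex_of_real T"
    if s: "(\<lambda>j. complex_of_real (c j) * iexp (t * x j)) sums s" for t s
  proof -
    have eq: "(c j / T) *\<^sub>R iexp (t * x j) = complex_of_real (c j) * iexp (t * x j) / complex_of_real T" for j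
      by (simp add: scaleR_conv_of_real)
    have int: "integrable (count_space UNIV) (\<lambda>j. (c j / T) *\<^sub>R iexp (t * x j))"
      using c1 nonneg T by (simp add: integrable_count_space_nat_iff norm_mult sums_iff)
    have "char (distr (measure_pmf p) borel x) t = (\<integral>j. iexp (t * x j) \<partial>measure_pmf p)"
      unfolding char_def by (rule integral_distr) auto
    also have "\<dots> = (\<integral>j. pmf p j *\<^sub>R iexp (t * x j) \<partial>count_space UNIV)"
      unfolding measure_pmf_eq_density by (rule integral_density) auto
    also have "\<dots> = (\<Sum>j. (c j / T) *\<^sub>R iexp (t * x j))"
      unfolding pmf_p by (rule integral_count_space_nat[OF int])
    also have "\<dots> = s / complex_of_real T"
      unfolding eq using sums_divide[OF s] by (simp only: sums_iff)
    finally show ?thesis .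
  qed
  ultimately show thesis using that by blast
qed

text \<open>Merges two series into one, so that a single discrete measure carries both; the index
  arithmetic is that of \<open>sums_if\<close>.\<close>

definition interleave :: "(nat \<Rightarrow> 'a) \<Rightarrow> (nat \<Rightarrow> 'a) \<Rightarrow> nat \<Rightarrow> 'a" where
  "interleave a b j = (if even j then a (j div 2) else b ((j - 1) div 2))"

lemma sums_interleave:
  assumes "a sums x" "b sums y"
  shows "interleave a b sums (x + y :: real)"
  unfolding interleave_def[abs_def] add.commute[of x y] by (rule sums_if[OF assms(2,1)])

lemma sums_interleave_complex:
  assumes "a sums x" "b sums y"
  shows "interleave a b sums (x + y :: complex)"
proof -
  have "F \<circ> interleave a b = interleave (F \<circ> a) (F \<circ> b)" for F :: "complex \<Rightarrow> real"
    by (auto simp: interleave_def)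
  moreover have "(Re \<circ> a) sums Re x" "(Re \<circ> b) sums Re y" "(Im \<circ> a) sums Im x" "(Im \<circ> b) sums Im y"
    using assms by (simp_all add: sums_complex_iff o_def)
  ultimately show ?thesis
    using sums_interleave[of "Re \<circ> a" "Re x" "Re \<circ> b" "Re y"] sums_interleave[of "Im \<circ> a" "Im x" "Im \<circ> b" "Im y"]
    by (simp add: sums_complex_iff o_def)
qed

section \<open>Integrals against powers of the Cauchy kernel\<close>

definition kernel_integral :: "(real \<Rightarrow> complex) \<Rightarrow> nat \<Rightarrow> complex \<Rightarrow> complex" where
  "kernel_integral f n w = (1 / complex_of_real pi) *
     (\<integral>t. f t / (w + \<i> * complex_of_real t) ^ Suc n \<partial>lborel)"

text \<open>The modulus of \<open>w + i t\<close> dominates both \<open>Re w\<close> and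
  \<open>Im w + t\<close>. Hence the weight \<open>1 / (1 + |t|)\<close> controls the Cauchy kernel
  at every point of the right half-plane.\<close>

lemma one_plus_abs_le_norm:
  assumes "Re w > 0"
  shows "1 + \<bar>t\<bar> \<le> ((1 + \<bar>Im w\<bar>) / Re w + 1) * norm (w + \<i> * complex_of_real t)"
proof -
  let ?N = "norm (w + \<i> * complex_of_real t)"
  have "Re w \<le> ?N" using complex_Re_le_cmod[of "w + \<i> * complex_of_real t"] by simp
  hence "(1 + \<bar>Im w\<bar>) / Re w * Re w \<le> (1 + \<bar>Im w\<bar>) / Re w * ?N"
    using assms by (intro mult_left_mono) auto
  hence "1 + \<bar>Im w\<bar> \<le> (1 + \<bar>Im w\<bar>) / Re w * ?N" using assms by simp
  moreover have "\<bar>Im w + t\<bar> \<le> ?N" using abs_Im_le_cmod[of "w + \<i> * complex_of_real t"] by simp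
  moreover have "1 + \<bar>t\<bar> \<le> (1 + \<bar>Im w\<bar>) + \<bar>Im w + t\<bar>" by linarith
  ultimately show ?thesis unfolding distrib_right by linarith
qed

lemma minus_one_power_mult: "(-1) ^ n * x * u ^ n = x * (- u) ^ n" for x u :: "'a::comm_ring_1"
  by (subst power_minus) (simp add: mult_ac)

lemma Re_le_norm_add_ii: "Re w \<le> norm (w + \<i> * complex_of_real t)"
  using complex_Re_le_cmod[of "w + \<i> * complex_of_real t"] by simp

lemma add_ii_nonzero: "Re w > 0 \<Longrightarrow> w + \<i> * complex_of_real t \<noteq> 0"
  using Re_le_norm_add_ii[of w t] by auto

locale weighted_integrable =
  fixes f :: "real \<Rightarrow> complex"
  assumes meas [measurable]: "f \<in> borel_measurable borel"
    and weight: "integrable lborel (\<lambda>t. norm (f t) / (1 + \<bar>t\<bar>))"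
begin

text \<open>One factor of the denominator pays for the weight, and the remaining \<open>n\<close>
  factors are bounded below by \<open>Re w\<close>. Keeping \<open>Re w ^ n\<close> explicit yields
  the geometric majorant for the power series.\<close>

lemma norm_kernel_le:
  assumes "Re w > 0"
  shows "norm (f t / (w + \<i> * complex_of_real t) ^ Suc n)
    \<le> ((1 + \<bar>Im w\<bar>) / Re w + 1) / Re w ^ n * (norm (f t) / (1 + \<bar>t\<bar>))"
proof -
  let ?N = "norm (w + \<i> * complex_of_real t)" and ?C = "(1 + \<bar>Im w\<bar>) / Re w + 1"
  have N: "0 < ?N" using add_ii_nonzero[OF assms] by simp
  have C: "0 < ?C" using assms by (intro add_nonneg_pos) auto
  have "Re w ^ n * (1 + \<bar>t\<bar>) \<le> ?N ^ n * (?C * ?N)"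
    using one_plus_abs_le_norm[OF assms, of t] assms Re_le_norm_add_ii[of w t]
    by (intro mult_mono power_mono) auto
  moreover have "1 / x \<le> c / y" if "y \<le> x * c" "0 < x" "0 < y" for x y c :: real
    using that by (simp add: field_simps)
  ultimately have "1 / ?N ^ Suc n \<le> ?C / (Re w ^ n * (1 + \<bar>t\<bar>))"
    using N assms by (simp add: mult_ac)
  hence "norm (f t) * (1 / ?N ^ Suc n) \<le> norm (f t) * (?C / (Re w ^ n * (1 + \<bar>t\<bar>)))"
    by (intro mult_left_mono) auto
  thus ?thesis by (simp add: norm_divide norm_power norm_mult mult_ac)
qed

lemma integrable_kernel:
  assumes "Re w > 0"
  shows "integrable lborel (\<lambda>t. f t / (w + \<i> * complex_of_real t) ^ Suc n)"
proof (rule Bochner_Integration.integrable_bound)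
  show "integrable lborel (\<lambda>t. ((1 + \<bar>Im w\<bar>) / Re w + 1) / Re w ^ n * (norm (f t) / (1 + \<bar>t\<bar>)))"
    by (intro integrable_mult_right weight)
  show "AE t in lborel. norm (f t / (w + \<i> * complex_of_real t) ^ Suc n)
      \<le> norm (((1 + \<bar>Im w\<bar>) / Re w + 1) / Re w ^ n * (norm (f t) / (1 + \<bar>t\<bar>)))"
    using norm_kernel_le[OF assms] by (intro AE_I2) (metis abs_ge_self order_trans real_norm_def)
qed measurable

text \<open>Expand \<open>1 / (w + i t)\<close> as a geometric series with ratio
  \<open>(a - w) / (a + i t)\<close>. As the denominator has modulus at least \<open>a\<close>, the
  ratio is bounded by \<open>q < 1\<close> uniformly in \<open>t\<close>, which justifies
  integrating term by term. The disc extends up to the imaginary axis, so \<open>w\<close> may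
  approach that axis later.\<close>

lemma kernel_integral_power_series:
  assumes a: "norm (w - complex_of_real a) < a"
  shows "(\<lambda>n. kernel_integral f n (complex_of_real a) * (complex_of_real a - w) ^ n)
    sums kernel_integral f 0 w"
proof -
  let ?a = "complex_of_real a"
  let ?g = "\<lambda>n t. f t / (?a + \<i> * complex_of_real t) ^ Suc n * (?a - w) ^ n"
  define q where "q = norm (?a - w) / a"
  have a0: "a > 0" using a norm_ge_zero[of "w - ?a"] by linarith
  have q: "0 \<le> q" "q < 1" using a a0 by (auto simp: q_def norm_minus_commute)
  define C where "C = (1 + \<bar>Im ?a\<bar>) / a + 1"
  have int: "integrable lborel (?g n)" for n
    using integrable_kernel[of ?a n] a0 by (intro integrable_mult_left) simp
  have bound: "norm (?g n t) \<le> C * (norm (f t) / (1 + \<bar>t\<bar>)) * q ^ n" for n t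
  proof -
    have "norm (?g n t) \<le> C / a ^ n * (norm (f t) / (1 + \<bar>t\<bar>)) * norm (?a - w) ^ n"
      using norm_kernel_le[of ?a, where n=n and t=t] a0 unfolding C_def norm_mult norm_power
      by (intro mult_right_mono) auto
    also have "\<dots> = C * (norm (f t) / (1 + \<bar>t\<bar>)) * q ^ n"
      using a0 by (simp add: q_def power_divide)
    finally show ?thesis .
  qed
  have sumq: "summable (\<lambda>n. c * q ^ n)" for c :: real
    using q by (intro summable_mult summable_geometric) auto
  have sm: "summable (\<lambda>n. norm (?g n t))" for t
    by (rule summable_comparison_test'[OF sumq[of "C * (norm (f t) / (1 + \<bar>t\<bar>))"], of 0]) (use bound[where t=t] in simp)
  have sums: "(\<lambda>n. ?g n t) sums (f t / (w + \<i> * complex_of_real t))" for t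
  proof -
    let ?z = "?a + \<i> * complex_of_real t" and ?x = "(?a - w) / (?a + \<i> * complex_of_real t)"
    have z: "?z \<noteq> 0" using a0 by (intro add_ii_nonzero) simp
    have "norm (?a - w) < norm ?z"
      using a Re_le_norm_add_ii[of ?a t] by (simp add: norm_minus_commute)
    hence "norm ?x < 1" using z by (simp add: norm_divide)
    hence "(\<lambda>n. f t / ?z * ?x ^ n) sums (f t / ?z * (1 / (1 - ?x)))"
      by (intro sums_mult geometric_sums)
    also have "(\<lambda>n. f t / ?z * ?x ^ n) = (\<lambda>n. ?g n t)"
      by (simp add: power_divide)
    also have "f t / ?z * (1 / (1 - ?x)) = f t / (?z * (1 - ?x))" by simp
    also have "?z * (1 - ?x) = w + \<i> * complex_of_real t"
      using z by (subst right_diff_distrib) simp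
    finally show ?thesis .
  qed
  have "(\<lambda>n. integral\<^sup>L lborel (?g n)) sums (\<integral>t. (\<Sum>n. ?g n t) \<partial>lborel)"
  proof (rule sums_integral[OF int])
    show "AE t in lborel. summable (\<lambda>n. norm (?g n t))" using sm by simp
    define J where "J n = (\<integral>t. norm (?g n t) \<partial>lborel)" for n
    have "J n \<le> (\<integral>t. C * (norm (f t) / (1 + \<bar>t\<bar>)) * q ^ n \<partial>lborel)" for n
      unfolding J_def using bound
      by (intro integral_mono integrable_norm int integrable_mult_left integrable_mult_right weight)
    hence "J n \<le> (\<integral>t. C * (norm (f t) / (1 + \<bar>t\<bar>)) \<partial>lborel) * q ^ n" for n
      by (simp only: integral_mult_left_zero)
    moreover have "0 \<le> J n" for n by (simp add: J_def)
    ultimately have "summable J"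
      by (intro summable_comparison_test'[OF sumq, of 0]) simp
    thus "summable (\<lambda>n. \<integral>t. norm (?g n t) \<partial>lborel)"
      by (simp only: J_def[abs_def])
  qed
  also have "(\<integral>t. (\<Sum>n. ?g n t) \<partial>lborel) = (\<integral>t. f t / (w + \<i> * complex_of_real t) \<partial>lborel)"
    using sums by (simp add: sums_iff)
  finally have "(\<lambda>n. 1 / complex_of_real pi * integral\<^sup>L lborel (?g n)) sums
      (1 / complex_of_real pi * (\<integral>t. f t / (w + \<i> * complex_of_real t) \<partial>lborel))"
    by (rule sums_mult)
  thus ?thesis
    by (simp only: kernel_integral_def integral_mult_left_zero mult.assoc power_Suc0_right)
qed

text \<open>Uniqueness of Taylor coefficients; the sign arises because the series runs in powers of
  \<open>a - w\<close>.\<close>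

lemma kernel_integral_eq_higher_deriv:
  assumes "a > 0"
  shows "kernel_integral f n (complex_of_real a)
    = (-1) ^ n * (deriv ^^ n) (kernel_integral f 0) (complex_of_real a) / fact n"
proof -
  let ?a = "complex_of_real a"
  let ?F = "Abs_fps (\<lambda>n. (-1) ^ n * kernel_integral f n ?a)"
  have "(kernel_integral f 0 \<circ> (\<lambda>u. ?a + u)) has_fps_expansion ?F"
  proof (rule has_fps_expansionI)
    have "eventually (\<lambda>u. u \<in> ball 0 a) (nhds (0::complex))"
      using assms by (intro eventually_nhds_in_open) auto
    thus "\<forall>\<^sub>F u in nhds 0. (\<lambda>n. fps_nth ?F n * u ^ n) sums (kernel_integral f 0 \<circ> (\<lambda>u. ?a + u)) u"
    proof eventually_elim
      case (elim u)
      thus ?case using kernel_integral_power_series[of "?a + u" a]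
        by (simp add: minus_one_power_mult)
    qed
  qed
  from fps_nth_fps_expansion[OF this, of n]
  have *: "(-1) ^ n * kernel_integral f n ?a = (deriv ^^ n) (kernel_integral f 0) ?a / fact n"
    unfolding higher_deriv_shift_0[of n "kernel_integral f 0" ?a] by simp
  have "kernel_integral f n ?a = (-1) ^ n * ((-1) ^ n * kernel_integral f n ?a)"
    by (simp flip: mult.assoc power_mult_distrib)
  thus ?thesis unfolding * by simp
qed

text \<open>Differentiability is inherited from the holomorphic function
  \<open>kernel_integral f 0\<close>, whose higher derivatives on the positive axis are the kernel
  integrals up to constants.\<close>

lemma kernel_integral_has_derivative:
  assumes "y > 0"
  shows "((\<lambda>y. kernel_integral f n (complex_of_real y)) has_vector_derivative
    - of_nat (Suc n) * kernel_integral f (Suc n) (complex_of_real y)) (at y)"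
proof -
  let ?F = "kernel_integral f 0"
  have "?F holomorphic_on ball (complex_of_real y) y"
  proof (rule power_series_holomorphic)
    fix w assume "w \<in> ball (complex_of_real y) y"
    hence "norm (w - complex_of_real y) < y" by (simp add: dist_norm norm_minus_commute)
    thus "(\<lambda>n. (-1) ^ n * kernel_integral f n (complex_of_real y) * (w - complex_of_real y) ^ n) sums ?F w"
      using kernel_integral_power_series[of w y] by (simp add: minus_one_power_mult)
  qed
  hence "(deriv ^^ n) ?F holomorphic_on ball (complex_of_real y) y"
    by (intro holomorphic_higher_deriv) auto
  hence "((deriv ^^ n) ?F has_field_derivative (deriv ^^ Suc n) ?F (complex_of_real y)) (at (complex_of_real y))"
    using assms by (auto intro!: holomorphic_derivI)
  hence "((\<lambda>w. (-1) ^ n * (deriv ^^ n) ?F w / fact n) has_field_derivative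
      (-1) ^ n * (deriv ^^ Suc n) ?F (complex_of_real y) / fact n) (at (complex_of_real y))"
    by (intro DERIV_cdivide DERIV_cmult)
  hence "((\<lambda>y. (-1) ^ n * (deriv ^^ n) ?F (complex_of_real y) / fact n) has_vector_derivative
      (-1) ^ n * (deriv ^^ Suc n) ?F (complex_of_real y) / fact n) (at y)"
    by (rule has_vector_derivative_real_field)
  moreover have "(-1) ^ n * (deriv ^^ Suc n) ?F (complex_of_real y) / fact n
      = - of_nat (Suc n) * kernel_integral f (Suc n) (complex_of_real y)"
    unfolding kernel_integral_eq_higher_deriv[OF assms] by (simp add: field_simps del: of_nat_Suc)
  ultimately have *: "((\<lambda>y. (-1) ^ n * (deriv ^^ n) ?F (complex_of_real y) / fact n) has_vector_derivative
      - of_nat (Suc n) * kernel_integral f (Suc n) (complex_of_real y)) (at y)" by simp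
  show ?thesis
    by (rule has_vector_derivative_transform_within_open[OF *, of "{0<..}"])
       (use assms in \<open>auto simp: kernel_integral_eq_higher_deriv\<close>)
qed

text \<open>Derivatives are unique on the open half-line, so any admissible family \<open>D\<close>
  agrees there with \<open>(-1) ^ n * fact n\<close> times the kernel integrals. Membership in the
  nonnegative reals encodes realness and sign together.\<close>

lemma completely_monotonic_iff_kernel_integral:
  "(\<exists>w. (\<forall>y>0. kernel_integral f 0 (complex_of_real y) = complex_of_real (w y)) \<and>
        completely_monotonic_on {0<..} w) \<longleftrightarrow>
   (\<forall>n. \<forall>a>0. kernel_integral f n (complex_of_real a) \<in> \<real>\<^sub>\<ge>\<^sub>0)"
proof
  assume "\<exists>w. (\<forall>y>0. kernel_integral f 0 (complex_of_real y) = complex_of_real (w y)) \<and>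
        completely_monotonic_on {0<..} w"
  then obtain w where w: "\<And>y. y > 0 \<Longrightarrow> kernel_integral f 0 (complex_of_real y) = complex_of_real (w y)"
    and "completely_monotonic_on {0<..} w" by blast
  then obtain D where D': "derivs_on {0<..} w D"
    and sgn': "\<forall>n. \<forall>x\<in>{0<..}. 0 \<le> (-1) ^ n * D n x"
    unfolding completely_monotonic_on_def by blast
  have D0: "D 0 y = w y" if "y > 0" for y
    using D' that by (simp add: derivs_on_def)
  have D: "(D n has_real_derivative D (Suc n) y) (at y)" if "y > 0" for n y
    using D' that by (simp add: derivs_on_def)
  have sgn: "(-1) ^ n * D n y \<ge> 0" if "y > 0" for n y
    using sgn' that by simp
  have eq: "kernel_integral f n (complex_of_real y) = complex_of_real ((-1) ^ n * D n y / fact n)"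
    if "y > 0" for n y
    using that
  proof (induction n arbitrary: y)
    case (Suc n)
    have "((\<lambda>y. (-1) ^ n * D n y / fact n) has_real_derivative (-1) ^ n * D (Suc n) y / fact n) (at y)"
      by (intro DERIV_cdivide DERIV_cmult D Suc.prems)
    hence "((\<lambda>y. complex_of_real ((-1) ^ n * D n y / fact n)) has_vector_derivative
        complex_of_real ((-1) ^ n * D (Suc n) y / fact n)) (at y)"
      by (intro has_vector_derivative_of_real) (simp add: has_real_derivative_iff_has_vector_derivative)
    hence "((\<lambda>y. kernel_integral f n (complex_of_real y)) has_vector_derivative
        complex_of_real ((-1) ^ n * D (Suc n) y / fact n)) (at y)"
      by (rule has_vector_derivative_transform_within_open[of _ _ _ "{0<..}"])
         (use Suc in auto)
    from vector_derivative_unique_at[OF this kernel_integral_has_derivative[OF Suc.prems]]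
    have "complex_of_real ((-1) ^ n * D (Suc n) y / fact n)
      = - of_nat (Suc n) * kernel_integral f (Suc n) (complex_of_real y)" .
    hence "kernel_integral f (Suc n) (complex_of_real y)
      = - complex_of_real ((-1) ^ n * D (Suc n) y / fact n) / of_nat (Suc n)"
      by (simp add: field_simps del: of_nat_Suc)
    thus ?case by (simp add: field_simps del: of_nat_Suc)
  qed (simp add: w D0)
  show "\<forall>n. \<forall>a>0. kernel_integral f n (complex_of_real a) \<in> \<real>\<^sub>\<ge>\<^sub>0"
    using eq sgn by (simp del: of_real_divide of_real_mult)
next
  assume *: "\<forall>n. \<forall>a>0. kernel_integral f n (complex_of_real a) \<in> \<real>\<^sub>\<ge>\<^sub>0"
  \<comment> \<open>The sign and the factorial absorb the factor \<open>- of_nat (Suc n)\<close> of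
    \<open>kernel_integral_has_derivative\<close>, so that each \<open>D n\<close> has derivative
    exactly \<open>D (Suc n)\<close>.\<close>
  define D where "D n y = (-1) ^ n * fact n * Re (kernel_integral f n (complex_of_real y))" for n y
  have "(D n has_real_derivative D (Suc n) y) (at y)" if "y > 0" for n y
  proof -
    have "((\<lambda>y. Re (kernel_integral f n (complex_of_real y))) has_vector_derivative
      Re (- of_nat (Suc n) * kernel_integral f (Suc n) (complex_of_real y))) (at y)"
      by (intro bounded_linear.has_vector_derivative[OF bounded_linear_Re] kernel_integral_has_derivative that)
    hence "((\<lambda>y. Re (kernel_integral f n (complex_of_real y))) has_real_derivative
      - real (Suc n) * Re (kernel_integral f (Suc n) (complex_of_real y))) (at y)"
      by (simp add: has_real_derivative_iff_has_vector_derivative)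
    from DERIV_cmult[OF this, of "(-1) ^ n * fact n"]
    have "(D n has_real_derivative (-1) ^ n * fact n *
        (- real (Suc n) * Re (kernel_integral f (Suc n) (complex_of_real y)))) (at y)"
      by (simp only: D_def[abs_def])
    also have "(-1) ^ n * fact n * (- real (Suc n) * Re (kernel_integral f (Suc n) (complex_of_real y)))
        = D (Suc n) y"
      unfolding D_def by (simp add: algebra_simps)
    finally show ?thesis .
  qed
  moreover have "(-1) ^ n * D n y \<ge> 0" if "y > 0" for n y
    using * that by (simp add: D_def complex_nonneg_Reals_iff flip: mult.assoc power_mult_distrib)
  ultimately have "completely_monotonic_on {0<..} (D 0)"
    by (auto simp: completely_monotonic_on_def derivs_on_def)
  moreover have "kernel_integral f 0 (complex_of_real y) = complex_of_real (D 0 y)" if "y > 0" for y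
    using * that by (auto simp: D_def complex_nonneg_Reals_iff complex_eq_iff)
  ultimately show "\<exists>w. (\<forall>y>0. kernel_integral f 0 (complex_of_real y) = complex_of_real (w y)) \<and>
        completely_monotonic_on {0<..} w" by blast
qed

end

section \<open>The two halves of the imaginary axis and reflection\<close>

lemma cauchy_transform_imaginary_axis:
  "cauchy_transform f (\<i> * complex_of_real y) = kernel_integral f 0 (complex_of_real y)"
proof -
  have "f t / (\<i> * complex_of_real y - complex_of_real t)
      = - \<i> * (f t / (complex_of_real y + \<i> * complex_of_real t))" for t
  proof -
    have "\<i> * complex_of_real y - complex_of_real t = (complex_of_real y + \<i> * complex_of_real t) * \<i>"
      by (simp add: algebra_simps)
    hence "f t / (\<i> * complex_of_real y - complex_of_real t)
        = f t / (complex_of_real y + \<i> * complex_of_real t) / \<i>"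
      by (simp only: divide_divide_eq_left)
    thus ?thesis by simp
  qed
  thus ?thesis
    by (simp only: cauchy_transform_def kernel_integral_def integral_mult_right_zero) simp
qed

lemma minus_cauchy_transform_imaginary_axis:
  "- cauchy_transform f (\<i> * complex_of_real y) = kernel_integral (\<lambda>t. f (- t)) 0 (complex_of_real (- y))"
proof -
  have "(\<integral>t. f t / (complex_of_real y + \<i> * complex_of_real t) \<partial>lborel)
      = (\<integral>t. f (- t) / (complex_of_real y - \<i> * complex_of_real t) \<partial>lborel)"
    by (subst lborel_integral_real_affine[where c="-1" and t=0]) auto
  also have "\<dots> = (\<integral>t. - (f (- t) / (complex_of_real (- y) + \<i> * complex_of_real t)) \<partial>lborel)"
  proof (intro Bochner_Integration.integral_cong refl)
    fix t
    have "complex_of_real y - \<i> * complex_of_real t = - (complex_of_real (- y) + \<i> * complex_of_real t)"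
      by simp
    thus "f (- t) / (complex_of_real y - \<i> * complex_of_real t)
      = - (f (- t) / (complex_of_real (- y) + \<i> * complex_of_real t))"
      by (metis divide_minus_right)
  qed
  finally show ?thesis
    by (simp add: cauchy_transform_imaginary_axis kernel_integral_def del: of_real_minus)
qed

lemma has_real_derivative_reflect_alternating:
  assumes "(g has_real_derivative g') (at (- x))"
  shows "((\<lambda>x. (-1) ^ n * g (- x)) has_real_derivative (-1) ^ Suc n * g') (at x)"
proof -
  have "((\<lambda>x. g (- x)) has_real_derivative - g') (at x)"
    using assms by (simp only: DERIV_mirror)
  from DERIV_cmult[OF this, of "(-1) ^ n"] show ?thesis by simp
qed

text \<open>Every differentiation of a reflected function brings out a factor -1, which is the
  alternation in complete monotonicity; hence the same family \<open>E\<close> in both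
  directions.\<close>

lemma absolutely_monotonic_reflect:
  "absolutely_monotonic_on {..<0} w \<longleftrightarrow> completely_monotonic_on {0<..} (\<lambda>y. w (- y))"
proof
  assume "absolutely_monotonic_on {..<0} w"
  then obtain D where D: "derivs_on {..<0} w D" and nonneg: "\<forall>n. \<forall>x\<in>{..<0}. D n x \<ge> 0"
    unfolding absolutely_monotonic_on_def by blast
  define E where "E n x = (-1) ^ n * D n (- x)" for n x
  have "(E n has_real_derivative E (Suc n) x) (at x)" if "x > 0" for n x
    unfolding E_def using D that by (intro has_real_derivative_reflect_alternating) (simp add: derivs_on_def)
  moreover have "E 0 x = w (- x)" if "x > 0" for x
    using D that by (simp add: derivs_on_def E_def)
  ultimately have "derivs_on {0<..} (\<lambda>y. w (- y)) E"
    by (simp add: derivs_on_def)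
  moreover have "(-1) ^ n * E n x \<ge> 0" if "x > 0" for n x
    using nonneg that by (simp add: E_def flip: mult.assoc power_mult_distrib)
  ultimately show "completely_monotonic_on {0<..} (\<lambda>y. w (- y))"
    unfolding completely_monotonic_on_def by (metis greaterThan_iff)
next
  assume "completely_monotonic_on {0<..} (\<lambda>y. w (- y))"
  then obtain D where D: "derivs_on {0<..} (\<lambda>y. w (- y)) D" and nonneg: "\<forall>n. \<forall>x\<in>{0<..}. (-1) ^ n * D n x \<ge> 0"
    unfolding completely_monotonic_on_def by blast
  define E where "E n x = (-1) ^ n * D n (- x)" for n x
  have "(E n has_real_derivative E (Suc n) x) (at x)" if "x < 0" for n x
    unfolding E_def using D that by (intro has_real_derivative_reflect_alternating) (simp add: derivs_on_def)
  moreover have "E 0 x = w x" if "x < 0" for x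
    using D that by (simp add: derivs_on_def E_def)
  ultimately have "derivs_on {..<0} w E"
    by (simp add: derivs_on_def)
  moreover have "E n x \<ge> 0" if "x < 0" for n x
    using nonneg that by (simp add: E_def)
  ultimately show "absolutely_monotonic_on {..<0} w"
    unfolding absolutely_monotonic_on_def by (metis lessThan_iff)
qed

section \<open>Characteristic functions have nonnegative kernel integrals\<close>

text \<open>The substitution \<open>t = m * u\<close> exhibits a normal average as a Lebesgue
  integral with the cutoff \<open>exp (- (t / m)\<^sup>2 / 2)\<close>, which tends to 1 as
  \<open>m\<close> grows.\<close>

lemma std_normal_integral_scale:
  fixes g :: "real \<Rightarrow> complex"
  assumes [measurable]: "g \<in> borel_measurable borel" and m: "m > 0"
  shows "complex_of_real (m * sqrt (2 * pi)) * (\<integral>u. g (m * u) \<partial>std_normal_distribution)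
    = (\<integral>t. complex_of_real (exp (- (t / m)\<^sup>2 / 2)) * g t \<partial>lborel)"
proof -
  have "(\<integral>t. complex_of_real (exp (- (t / m)\<^sup>2 / 2)) * g t \<partial>lborel)
      = \<bar>m\<bar> *\<^sub>R (\<integral>u. complex_of_real (exp (- ((0 + m * u) / m)\<^sup>2 / 2)) * g (0 + m * u) \<partial>lborel)"
    by (rule lborel_integral_real_affine) (use m in simp)
  also have "\<dots> = m *\<^sub>R (\<integral>u. complex_of_real (exp (- u\<^sup>2 / 2)) * g (m * u) \<partial>lborel)"
    using m by simp
  finally have 1: "(\<integral>t. complex_of_real (exp (- (t / m)\<^sup>2 / 2)) * g t \<partial>lborel)
      = m *\<^sub>R (\<integral>u. complex_of_real (exp (- u\<^sup>2 / 2)) * g (m * u) \<partial>lborel)" .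
  have "(\<integral>u. g (m * u) \<partial>std_normal_distribution)
      = (\<integral>u. std_normal_density u *\<^sub>R g (m * u) \<partial>lborel)"
    by (rule integral_density) simp_all
  also have "(\<integral>u. std_normal_density u *\<^sub>R g (m * u) \<partial>lborel)
      = (\<integral>u. complex_of_real (1 / sqrt (2 * pi)) * (complex_of_real (exp (- u\<^sup>2 / 2)) * g (m * u)) \<partial>lborel)"
    by (intro Bochner_Integration.integral_cong refl) (simp add: std_normal_density_def scaleR_conv_of_real)
  finally have 2: "(\<integral>u. g (m * u) \<partial>std_normal_distribution)
      = complex_of_real (1 / sqrt (2 * pi)) * (\<integral>u. complex_of_real (exp (- u\<^sup>2 / 2)) * g (m * u) \<partial>lborel)"
    by (simp only: integral_mult_right_zero)
  have "m * sqrt (2 * pi) * (1 / sqrt (2 * pi)) = m" by simp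
  thus ?thesis unfolding 1 2
    by (simp only: scaleR_conv_of_real flip: mult.assoc of_real_mult)
qed

context weighted_integrable
begin

lemma kernel_integral_nonneg_of_char:
  assumes M: "real_distribution M" "\<And>t. f t = char M t" and a: "a > 0"
  shows "kernel_integral f n (complex_of_real a) \<in> \<real>\<^sub>\<ge>\<^sub>0"
proof -
  let ?g = "\<lambda>t. f t / (complex_of_real a + \<i> * complex_of_real t) ^ Suc n"
  let ?h = "\<lambda>k t. complex_of_real (exp (- (t / real (Suc k))\<^sup>2 / 2)) * ?g t"
  obtain D where D: "real_distribution D"
    "\<And>t. char D t = char M t * char (density lborel (erlang_density n a)) (- t)"
    using char_distr_diff[OF M(1) real_distribution_erlang[OF a]] by blast
  \<comment> \<open>Up to a positive constant the integrand is itself a characteristic function: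
    that of a variable with law \<open>M\<close> minus an independent Erlang variable.\<close>
  have g: "?g t = complex_of_real (1 / a ^ Suc n) * char D t" for t
    using a by (simp add: D(2) M(2) char_erlang)
  have gm: "?g \<in> borel_measurable borel" by measurable
  have "(\<integral>t. ?h k t \<partial>lborel) \<in> \<real>\<^sub>\<ge>\<^sub>0" for k
  proof -
    have "(\<integral>t. ?h k t \<partial>lborel)
        = complex_of_real (real (Suc k) * sqrt (2 * pi)) * (\<integral>u. ?g (real (Suc k) * u) \<partial>std_normal_distribution)"
      by (rule std_normal_integral_scale[OF gm, symmetric]) simp
    also have "(\<integral>u. ?g (real (Suc k) * u) \<partial>std_normal_distribution)
        = complex_of_real (1 / a ^ Suc n) * (\<integral>u. char D (real (Suc k) * u) \<partial>std_normal_distribution)"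
      by (simp only: g integral_mult_right_zero)
    also have "(\<integral>u. char D (real (Suc k) * u) \<partial>std_normal_distribution)
        = complex_of_real (\<integral>x. exp (- (real (Suc k) * x)\<^sup>2 / 2) \<partial>D)"
      by (rule char_std_normal_scaled_integral[OF D(1)])
    finally have "(\<integral>t. ?h k t \<partial>lborel) = complex_of_real (real (Suc k) * sqrt (2 * pi) * (1 / a ^ Suc n *
        (\<integral>x. exp (- (real (Suc k) * x)\<^sup>2 / 2) \<partial>D)))"
      by (simp only: of_real_mult)
    moreover have "0 \<le> real (Suc k) * sqrt (2 * pi) * (1 / a ^ Suc n * (\<integral>x. exp (- (real (Suc k) * x)\<^sup>2 / 2) \<partial>D))"
      using a by (intro mult_nonneg_nonneg integral_nonneg) auto
    ultimately show ?thesis by (simp only: nonneg_Reals_of_real_iff)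
  qed
  \<comment> \<open>Removal of the cutoff: \<open>?g\<close> is integrable by the weight hypothesis,
    so its modulus is a majorant, and the sign survives because the nonnegative reals are
    closed.\<close>
  moreover have "(\<lambda>k. \<integral>t. ?h k t \<partial>lborel) \<longlonglongrightarrow> (\<integral>t. ?g t \<partial>lborel)"
  proof (rule integral_dominated_convergence[where w="\<lambda>t. norm (?g t)"])
    show "integrable lborel (\<lambda>t. norm (?g t))"
      using a by (intro integrable_norm integrable_kernel) simp
    have "(\<lambda>k. complex_of_real (exp (- (t / real (Suc k))\<^sup>2 / 2))) \<longlonglongrightarrow> complex_of_real 1" for t
    proof (rule tendsto_of_real)
      have "(\<lambda>k. t / real (Suc k)) \<longlonglongrightarrow> 0"
        unfolding divide_inverse by (rule tendsto_mult_right_zero[OF LIMSEQ_inverse_real_of_nat])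
      hence "(\<lambda>k. exp (- (t / real (Suc k))\<^sup>2 / 2)) \<longlonglongrightarrow> exp (- 0\<^sup>2 / 2)"
        by (intro tendsto_intros) auto
      thus "(\<lambda>k. exp (- (t / real (Suc k))\<^sup>2 / 2)) \<longlonglongrightarrow> 1" by simp
    qed
    hence "(\<lambda>k. ?h k t) \<longlonglongrightarrow> complex_of_real 1 * ?g t" for t
      by (rule tendsto_mult_right)
    thus "AE t in lborel. (\<lambda>k. ?h k t) \<longlonglongrightarrow> ?g t" by simp
    have "norm (?h k t) \<le> 1 * norm (?g t)" for k t
      unfolding norm_mult by (intro mult_right_mono) auto
    thus "AE t in lborel. norm (?h k t) \<le> norm (?g t)" for k by simp
  qed measurable
  ultimately have "(\<integral>t. ?g t \<partial>lborel) \<in> \<real>\<^sub>\<ge>\<^sub>0"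
    by (rule closed_sequentially[OF closed_nonneg_Reals_complex])
  moreover have "1 / complex_of_real pi \<in> \<real>\<^sub>\<ge>\<^sub>0"
    using nonneg_Reals_of_real_iff[of "1 / pi"] by simp
  ultimately show ?thesis
    unfolding kernel_integral_def by (rule nonneg_Reals_mult_I[rotated])
qed

end

section \<open>Nonnegative kernel integrals yield a characteristic function\<close>

lemma lborel_integral_inverse_1_plus_square:
  "integrable lborel (\<lambda>x::real. inverse (1 + x\<^sup>2))" "(\<integral>x. inverse (1 + x\<^sup>2) \<partial>lborel) = pi"
proof -
  show "integrable lborel (\<lambda>x::real. inverse (1 + x\<^sup>2))"
    using integrable_inverse_1_plus_square by (simp add: set_integrable_def)
  show "(\<integral>x. inverse (1 + x\<^sup>2) \<partial>lborel) = pi"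
    using LBINT_inverse_1_plus_square
    by (simp add: interval_lebesgue_integral_def set_lebesgue_integral_def)
qed

lemma weighted_integrable_reflect:
  assumes "weighted_integrable f"
  shows "weighted_integrable (\<lambda>t. f (- t))"
proof -
  interpret weighted_integrable f by fact
  show ?thesis
  proof
    show "integrable lborel (\<lambda>t. norm (f (- t)) / (1 + \<bar>t\<bar>))"
      using lborel_integrable_real_affine[OF weight, of "-1" 0] by simp
  qed measurable
qed

context weighted_integrable
begin

text \<open>The two Cauchy kernels add up to a Poisson kernel. The substitution
  \<open>t = Re w * x - Im w\<close> normalises it to \<open>2 / (1 + x^2)\<close>, so that
  \<open>w\<close> enters only through the argument of \<open>f\<close>.\<close>

lemma kernel_integral_add_reflect:
  assumes w: "Re w > 0"
  shows "kernel_integral f 0 w + kernel_integral (\<lambda>t. f (- t)) 0 (cnj w)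
    = 2 / complex_of_real pi * (\<integral>x. inverse (1 + x\<^sup>2) *\<^sub>R f (Re w * x - Im w) \<partial>lborel)"
proof -
  interpret r: weighted_integrable "\<lambda>t. f (- t)"
    by (rule weighted_integrable_reflect) (rule weighted_integrable_axioms)
  let ?z = "\<lambda>t. w + \<i> * complex_of_real t"
  have int: "integrable lborel (\<lambda>t. f t / ?z t)"
    using integrable_kernel[OF w, of 0] by simp
  have "integrable lborel (\<lambda>t. f (- t) / (cnj w + \<i> * complex_of_real t))"
    using r.integrable_kernel[of "cnj w" 0] w by simp
  from lborel_integrable_real_affine[OF this, of "-1" 0]
  have int': "integrable lborel (\<lambda>t. f t / cnj (?z t))" by simp
  have "(\<integral>t. f (- t) / (cnj w + \<i> * complex_of_real t) \<partial>lborel)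
      = \<bar>-1::real\<bar> *\<^sub>R (\<integral>t. f (- (0 + - 1 * t)) / (cnj w + \<i> * complex_of_real (0 + - 1 * t)) \<partial>lborel)"
    by (rule lborel_integral_real_affine) simp
  also have "\<dots> = (\<integral>t. f t / cnj (?z t) \<partial>lborel)" by simp
  finally have "kernel_integral f 0 w + kernel_integral (\<lambda>t. f (- t)) 0 (cnj w)
      = 1 / complex_of_real pi * ((\<integral>t. f t / ?z t \<partial>lborel) + (\<integral>t. f t / cnj (?z t) \<partial>lborel))"
    by (simp only: kernel_integral_def power_Suc0_right distrib_left)
  also have "(\<integral>t. f t / ?z t \<partial>lborel) + (\<integral>t. f t / cnj (?z t) \<partial>lborel)
      = (\<integral>t. f t / ?z t + f t / cnj (?z t) \<partial>lborel)"
    by (rule Bochner_Integration.integral_add[symmetric, OF int int'])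
  also have "\<dots> = \<bar>Re w\<bar> *\<^sub>R (\<integral>x. f (- Im w + Re w * x) / ?z (- Im w + Re w * x)
      + f (- Im w + Re w * x) / cnj (?z (- Im w + Re w * x)) \<partial>lborel)"
    by (rule lborel_integral_real_affine) (use w in simp)
  also have "\<dots> = (\<integral>x. 2 * (inverse (1 + x\<^sup>2) *\<^sub>R f (Re w * x - Im w)) \<partial>lborel)"
    unfolding integral_scaleR_right[symmetric]
  proof (intro Bochner_Integration.integral_cong refl)
    fix x :: real
    have z: "?z (- Im w + Re w * x) = complex_of_real (Re w) * (1 + \<i> * complex_of_real x)"
      by (simp add: complex_eq_iff)
    have nz: "1 + \<i> * complex_of_real x \<noteq> 0" "1 - \<i> * complex_of_real x \<noteq> 0"
      by (simp_all add: complex_eq_iff)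
    have "(1 + \<i> * complex_of_real x) * (1 - \<i> * complex_of_real x) = complex_of_real (1 + x\<^sup>2)"
      by (simp add: algebra_simps power2_eq_square)
    moreover have "1 / (1 + \<i> * complex_of_real x) + 1 / (1 - \<i> * complex_of_real x)
        = 2 / ((1 + \<i> * complex_of_real x) * (1 - \<i> * complex_of_real x))"
      using nz by (simp add: add_frac_eq)
    ultimately have eq: "1 / (1 + \<i> * complex_of_real x) + 1 / (1 - \<i> * complex_of_real x) = 2 * complex_of_real (inverse (1 + x\<^sup>2))"
      by (simp add: divide_inverse)
    have "\<bar>Re w\<bar> *\<^sub>R (y / (complex_of_real (Re w) * a) + y / (complex_of_real (Re w) * b)) = (1 / a + 1 / b) * y"
      for a b y using w by (simp add: scaleR_conv_of_real field_simps)
    note this[of "f (Re w * x - Im w)" "1 + \<i> * complex_of_real x" "1 - \<i> * complex_of_real x"]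
    thus "\<bar>Re w\<bar> *\<^sub>R (f (- Im w + Re w * x) / ?z (- Im w + Re w * x)
        + f (- Im w + Re w * x) / cnj (?z (- Im w + Re w * x))) = 2 * (inverse (1 + x\<^sup>2) *\<^sub>R f (Re w * x - Im w))"
      unfolding eq z by (simp add: scaleR_conv_of_real)
  qed
  finally show ?thesis by (simp only: integral_mult_right_zero) simp
qed

text \<open>The Poisson kernel is an approximate identity: in the rescaled variable the density is
  fixed, the argument of \<open>f\<close> tends to \<open>s\<close>, and boundedness of
  \<open>f\<close> gives the majorant. The total mass \<open>pi\<close> cancels the
  prefactor.\<close>

lemma kernel_integral_boundary_limit:
  assumes bdd: "bounded (range f)" and cont: "isCont f s"
    and w: "\<And>n. Re (w n) > 0" "(\<lambda>n. Re (w n)) \<longlonglongrightarrow> 0" "(\<lambda>n. Im (w n)) \<longlonglongrightarrow> - s"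
  shows "(\<lambda>n. kernel_integral f 0 (w n) + kernel_integral (\<lambda>t. f (- t)) 0 (cnj (w n))) \<longlonglongrightarrow> 2 * f s"
proof -
  obtain B where B: "\<And>t. norm (f t) \<le> B" using bdd by (auto simp: bounded_iff)
  have "(\<lambda>n. \<integral>x. inverse (1 + x\<^sup>2) *\<^sub>R f (Re (w n) * x - Im (w n)) \<partial>lborel)
      \<longlonglongrightarrow> (\<integral>x. inverse (1 + x\<^sup>2) *\<^sub>R f s \<partial>lborel)"
  proof (rule integral_dominated_convergence[where w="\<lambda>x. inverse (1 + x\<^sup>2) * B"])
    show "integrable lborel (\<lambda>x::real. inverse (1 + x\<^sup>2) * B)"
      by (intro integrable_mult_left lborel_integral_inverse_1_plus_square)
    have "(\<lambda>n. inverse (1 + x\<^sup>2) *\<^sub>R f (Re (w n) * x - Im (w n))) \<longlonglongrightarrow> inverse (1 + x\<^sup>2) *\<^sub>R f s" for x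
    proof (intro tendsto_scaleR tendsto_const isCont_tendsto_compose[OF cont])
      have "(\<lambda>n. Re (w n) * x - Im (w n)) \<longlonglongrightarrow> 0 * x - - s"
        by (intro tendsto_intros w)
      thus "(\<lambda>n. Re (w n) * x - Im (w n)) \<longlonglongrightarrow> s" by simp
    qed
    thus "AE x in lborel. (\<lambda>n. inverse (1 + x\<^sup>2) *\<^sub>R f (Re (w n) * x - Im (w n))) \<longlonglongrightarrow> inverse (1 + x\<^sup>2) *\<^sub>R f s"
      by simp
    have "norm (inverse (1 + x\<^sup>2) *\<^sub>R f (Re (w n) * x - Im (w n))) \<le> inverse (1 + x\<^sup>2) * B" for n x
      unfolding norm_scaleR by (intro mult_mono B) (auto simp: abs_if)
    thus "AE x in lborel. norm (inverse (1 + x\<^sup>2) *\<^sub>R f (Re (w n) * x - Im (w n))) \<le> inverse (1 + x\<^sup>2) * B" for n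
      by simp
  qed measurable
  also have "(\<integral>x. inverse (1 + x\<^sup>2) *\<^sub>R f s \<partial>lborel) = (\<integral>x. inverse (1 + x\<^sup>2) \<partial>lborel) *\<^sub>R f s"
    by (rule integral_scaleR_left) (intro lborel_integral_inverse_1_plus_square)
  finally have "(\<lambda>n. 2 / complex_of_real pi * (\<integral>x. inverse (1 + x\<^sup>2) *\<^sub>R f (Re (w n) * x - Im (w n)) \<partial>lborel))
      \<longlonglongrightarrow> 2 / complex_of_real pi * (pi *\<^sub>R f s)"
    unfolding lborel_integral_inverse_1_plus_square(2) by (rule tendsto_mult_left)
  thus ?thesis
    by (simp add: kernel_integral_add_reflect[OF w(1)] scaleR_conv_of_real)
qed

text \<open>As \<open>t\<close> varies, the argument moves on the circle of radius
  \<open>N * r\<close> about \<open>N\<close>, where the Taylor series at \<open>N\<close> becomes a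
  Fourier series with nonnegative coefficients.\<close>

lemma exponential_series_kernel_integral:
  assumes N: "N > 0" and r: "0 \<le> r" "r < 1"
    and nonneg: "\<And>n. kernel_integral f n (complex_of_real N) \<in> \<real>\<^sub>\<ge>\<^sub>0"
  shows "(\<lambda>k. complex_of_real (Re (kernel_integral f k (complex_of_real N)) * (N * r) ^ k) * iexp (t * (real k / N)))
    sums kernel_integral f 0 (complex_of_real N - complex_of_real (N * r) * iexp (t / N))"
proof -
  let ?w = "complex_of_real N - complex_of_real (N * r) * iexp (t / N)"
  have "norm (?w - complex_of_real N) < N"
    using assms by (simp add: norm_mult)
  from kernel_integral_power_series[OF this]
  have "(\<lambda>k. kernel_integral f k (complex_of_real N) * (complex_of_real (N * r) * iexp (t / N)) ^ k) sums kernel_integral f 0 ?w"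
    by simp
  moreover have "kernel_integral f k (complex_of_real N) * (complex_of_real (N * r) * iexp (t / N)) ^ k
    = complex_of_real (Re (kernel_integral f k (complex_of_real N)) * (N * r) ^ k) * iexp (t * (real k / N))" for k
  proof -
    have "kernel_integral f k (complex_of_real N) = complex_of_real (Re (kernel_integral f k (complex_of_real N)))"
      using nonneg[of k] by (simp add: complex_eq_iff complex_nonneg_Reals_iff)
    moreover have "iexp (t / N) ^ k = iexp (t * (real k / N))"
      by (simp add: exp_of_nat_mult[symmetric] mult_ac)
    ultimately show ?thesis by (simp add: power_mult_distrib)
  qed
  ultimately show ?thesis by simp
qed

text \<open>\<open>S\<close> is a series of exponentials with nonnegative coefficients, hence the
  transform of a positive measure of total mass \<open>S 0\<close>. The guard on \<open>S 0\<close>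
  keeps a distribution available in the degenerate case, where any law will do.\<close>

lemma ex_distribution_of_kernel_integral_nonneg:
  assumes N: "N > 0" and r: "0 \<le> r" "r < 1"
    and nonneg: "\<And>n. kernel_integral f n (complex_of_real N) \<in> \<real>\<^sub>\<ge>\<^sub>0"
      "\<And>n. kernel_integral (\<lambda>t. f (- t)) n (complex_of_real N) \<in> \<real>\<^sub>\<ge>\<^sub>0"
  defines "w \<equiv> \<lambda>t. complex_of_real N - complex_of_real (N * r) * iexp (t / N)"
  defines "S \<equiv> \<lambda>t. kernel_integral f 0 (w t) + kernel_integral (\<lambda>t. f (- t)) 0 (cnj (w t))"
  shows "\<exists>M. real_distribution M \<and> (S 0 \<noteq> 0 \<longrightarrow> (\<forall>t. char M t = S t / S 0))"
proof (cases "S 0 = 0")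
  case True
  thus ?thesis using real_dist_normal_dist by blast
next
  case False
  interpret r: weighted_integrable "\<lambda>t. f (- t)"
    by (rule weighted_integrable_reflect) (rule weighted_integrable_axioms)
  define a where "a k = Re (kernel_integral f k (complex_of_real N)) * (N * r) ^ k" for k
  define b where "b k = Re (kernel_integral (\<lambda>t. f (- t)) k (complex_of_real N)) * (N * r) ^ k" for k
  define c where "c = interleave a b"
  define x where "x = interleave (\<lambda>k. real k / N) (\<lambda>k. - (real k / N))"
  have ab: "0 \<le> a k" "0 \<le> b k" for k
    using nonneg N r by (auto simp: a_def b_def complex_nonneg_Reals_iff)
  have S: "(\<lambda>j. complex_of_real (c j) * iexp (t * x j)) sums S t" for t
  proof -
    have 1: "(\<lambda>k. complex_of_real (a k) * iexp (t * (real k / N))) sums kernel_integral f 0 (w t)"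
      unfolding a_def w_def by (intro exponential_series_kernel_integral assms)
    have 2: "(\<lambda>k. complex_of_real (b k) * iexp (- t * (real k / N))) sums kernel_integral (\<lambda>t. f (- t)) 0 (w (- t))"
      unfolding b_def w_def by (intro r.exponential_series_kernel_integral assms)
    \<comment> \<open>Conjugation reverses the direction of travel on the circle, so the reflected
      function contributes the frequencies \<open>- (k / N)\<close> in the variable
      \<open>t\<close>.\<close>
    have "cnj (w t) = w (- t)"
      by (simp add: w_def exp_cnj)
    with sums_interleave_complex[OF 1 2]
    have "interleave (\<lambda>k. complex_of_real (a k) * iexp (t * (real k / N)))
        (\<lambda>k. complex_of_real (b k) * iexp (- t * (real k / N))) sums S t"
      by (simp only: S_def)
    also have "interleave (\<lambda>k. complex_of_real (a k) * iexp (t * (real k / N)))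
        (\<lambda>k. complex_of_real (b k) * iexp (- t * (real k / N)))
      = (\<lambda>j. complex_of_real (c j) * iexp (t * x j))"
    proof
      fix j
      show "interleave (\<lambda>k. complex_of_real (a k) * iexp (t * (real k / N)))
          (\<lambda>k. complex_of_real (b k) * iexp (- t * (real k / N))) j
        = complex_of_real (c j) * iexp (t * x j)"
        unfolding interleave_def c_def x_def by (cases "even j") simp_all
    qed
    finally show ?thesis .
  qed
  define T where "T = Re (S 0)"
  have "(\<lambda>j. complex_of_real (c j)) sums S 0" using S[of 0] by simp
  hence c: "c sums T" and S0: "S 0 = complex_of_real T"
    unfolding T_def by (auto simp: sums_complex_iff complex_eq_iff sums_iff)
  have c_nonneg: "0 \<le> c j" for j
    unfolding c_def interleave_def using ab by (cases "even j") simp_all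
  have "0 \<le> T"
    using c c_nonneg sums_le[of "\<lambda>_. 0" c 0 T] by simp
  hence "T > 0" using False S0 by (cases "T = 0") auto
  then obtain M where "real_distribution M"
    "\<And>t s. (\<lambda>j. complex_of_real (c j) * iexp (t * x j)) sums s \<Longrightarrow> char M t = s / complex_of_real T"
    using ex_discrete_distribution[OF c_nonneg c] by blast
  thus ?thesis using S S0 by metis
qed

lemma is_char_fun_of_kernel_integral_nonneg:
  assumes bdd: "bounded (range f)" and cont: "\<And>s. isCont f s" and f0: "f 0 = 1"
    and nonneg: "\<And>n a. a > 0 \<Longrightarrow> kernel_integral f n (complex_of_real a) \<in> \<real>\<^sub>\<ge>\<^sub>0"
      "\<And>n a. a > 0 \<Longrightarrow> kernel_integral (\<lambda>t. f (- t)) n (complex_of_real a) \<in> \<real>\<^sub>\<ge>\<^sub>0"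
  shows "is_char_fun f"
proof -
  \<comment> \<open>With \<open>N = Suc m\<close>, the circle of radius \<open>N * r\<close> about
    \<open>N\<close> passes the origin at distance \<open>N * (1 - r) = 1 / N\<close>, while its
    growing radius flattens it towards the imaginary axis. At angle \<open>t / N\<close> the
    imaginary part tends to \<open>-t\<close>.\<close>
  define r where "r m = 1 - 1 / real (Suc m) ^ 2" for m
  define w where "w m t = complex_of_real (real (Suc m)) - complex_of_real (real (Suc m) * r m) * iexp (t / real (Suc m))" for m t
  define S where "S m t = kernel_integral f 0 (w m t) + kernel_integral (\<lambda>t. f (- t)) 0 (cnj (w m t))" for m t
  have r: "0 \<le> r m" "r m < 1" for m
    by (auto simp: r_def divide_simps)
  have Re_w: "Re (w m t) = real (Suc m) - real (Suc m) * r m * cos (t / real (Suc m))" for m t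
    by (simp add: w_def Re_exp del: of_nat_Suc)
  have Im_w: "Im (w m t) = - (real (Suc m) * r m * sin (t / real (Suc m)))" for m t
    by (simp add: w_def Im_exp del: of_nat_Suc)
  have S_lim: "(\<lambda>m. S m t) \<longlonglongrightarrow> 2 * f t" for t
    unfolding S_def
  proof (rule kernel_integral_boundary_limit[OF bdd cont])
    fix m
    have "real (Suc m) * (r m * cos (t / real (Suc m))) \<le> real (Suc m) * (r m * 1)"
      using r[of m] by (intro mult_left_mono) auto
    also have "\<dots> < real (Suc m) * 1"
      using r[of m] by (intro mult_strict_left_mono) auto
    finally show "Re (w m t) > 0" by (simp add: Re_w mult.assoc)
  next
    have h: "filterlim (\<lambda>m. inverse (real (Suc m))) (at 0) sequentially"
      by (rule filterlim_atI[OF LIMSEQ_inverse_real_of_nat]) simp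
    \<comment> \<open>\<open>N * (cos (t / N) - 1)\<close> and \<open>N * sin (t / N)\<close> are
      difference quotients at 0 with increment \<open>1 / N\<close>.\<close>
    have "((\<lambda>x. cos (t * x)) has_real_derivative 0) (at 0)" "((\<lambda>x. sin (t * x)) has_real_derivative t) (at 0)"
      by (auto intro!: derivative_eq_intros)
    hence "((\<lambda>x. (cos (t * x) - 1) / x) \<longlongrightarrow> 0) (at 0)" "((\<lambda>x. sin (t * x) / x) \<longlongrightarrow> t) (at 0)"
      by (simp_all add: DERIV_def)
    from this[THEN filterlim_compose, OF h]
    have C: "(\<lambda>m. real (Suc m) * (cos (t / real (Suc m)) - 1)) \<longlonglongrightarrow> 0"
      and S: "(\<lambda>m. real (Suc m) * sin (t / real (Suc m))) \<longlonglongrightarrow> t"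
      by (simp_all add: divide_inverse mult.commute del: of_nat_Suc)
    have "(\<lambda>m. t / real (Suc m)) \<longlonglongrightarrow> 0"
      unfolding divide_inverse by (rule tendsto_mult_right_zero[OF LIMSEQ_inverse_real_of_nat])
    hence "(\<lambda>m. cos (t / real (Suc m))) \<longlonglongrightarrow> cos 0"
      by (rule tendsto_cos)
    from tendsto_diff[OF tendsto_mult[OF LIMSEQ_inverse_real_of_nat this] C]
    have "(\<lambda>m. inverse (real (Suc m)) * cos (t / real (Suc m)) - real (Suc m) * (cos (t / real (Suc m)) - 1)) \<longlonglongrightarrow> 0"
      by (simp only: cos_zero mult_zero_left diff_self)
    \<comment> \<open>Since \<open>n * (1 - 1 / n^2) = n - 1 / n\<close>, the real part splits into
      two terms that both tend to 0.\<close>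
    moreover have "inverse n * c - n * (c - 1) = n - n * (1 - 1 / n\<^sup>2) * c" if "n \<noteq> 0" for n c :: real
      using that by (simp add: field_simps power2_eq_square)
    hence "inverse (real (Suc m)) * c - real (Suc m) * (c - 1) = real (Suc m) - real (Suc m) * r m * c" for m c
      using of_nat_neq_0 unfolding r_def by blast
    ultimately show "(\<lambda>m. Re (w m t)) \<longlonglongrightarrow> 0"
      unfolding Re_w by (simp only:)
    have "r \<longlonglongrightarrow> 1"
      using tendsto_diff[OF tendsto_const tendsto_power[OF LIMSEQ_inverse_real_of_nat, of 2], of 1]
      by (simp add: r_def[abs_def] power_inverse divide_inverse)
    from tendsto_minus[OF tendsto_mult[OF this S]]
    show "(\<lambda>m. Im (w m t)) \<longlonglongrightarrow> - t"
      unfolding Im_w by (simp add: mult_ac)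
  qed
  have "\<exists>M. real_distribution M \<and> (S m 0 \<noteq> 0 \<longrightarrow> (\<forall>t. char M t = S m t / S m 0))" for m
    unfolding S_def w_def
    by (intro ex_distribution_of_kernel_integral_nonneg r nonneg) simp_all
  then obtain M where M: "\<And>m. real_distribution (M m)"
    and char_M: "\<And>m t. S m 0 \<noteq> 0 \<Longrightarrow> char (M m) t = S m t / S m 0"
    by metis
  \<comment> \<open>As this limit is nonzero, the guard in \<open>char_M\<close> holds eventually,
    and normalising by \<open>S m 0\<close> turns the limit \<open>2 * f t\<close> into
    \<open>f t\<close>.\<close>
  have S0: "(\<lambda>m. S m 0) \<longlonglongrightarrow> 2" using S_lim[of 0] f0 by simp
  have "(\<lambda>m. char (M m) t) \<longlonglongrightarrow> f t" for t
  proof (rule Lim_transform_eventually)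
    show "(\<lambda>m. S m t / S m 0) \<longlonglongrightarrow> f t"
      using tendsto_divide[OF S_lim[of t] S0] by simp
    show "eventually (\<lambda>m. S m t / S m 0 = char (M m) t) sequentially"
      using tendsto_imp_eventually_ne[OF S0, of 0] by (auto elim!: eventually_mono simp: char_M)
  qed
  from levy_continuity_isCont[OF M this cont] show ?thesis
    unfolding is_char_fun_def by metis
qed

end

theorem theorem3:
  fixes f :: "real \<Rightarrow> complex"
  assumes "bounded (range f)"
    and "continuous_on UNIV f"
    and "f 0 = 1"
    and "integrable lborel (\<lambda>t. norm (f t) / (1 + \<bar>t\<bar>))"
  shows "is_char_fun f \<longleftrightarrow>
     ((\<exists>w. (\<forall>y>0. cauchy_transform f (\<i> * complex_of_real y) = complex_of_real (w y))
            \<and> completely_monotonic_on {0<..} w) \<and>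
      (\<exists>w. (\<forall>y<0. - cauchy_transform f (\<i> * complex_of_real y) = complex_of_real (w y))
            \<and> absolutely_monotonic_on {..<0} w))"
proof -
  have f: "weighted_integrable f"
    using assms(2,4) by unfold_locales (auto intro: borel_measurable_continuous_onI)
  have f': "weighted_integrable (\<lambda>t. f (- t))"
    by (rule weighted_integrable_reflect[OF f])
  have pos: "(\<exists>w. (\<forall>y>0. cauchy_transform f (\<i> * complex_of_real y) = complex_of_real (w y))
          \<and> completely_monotonic_on {0<..} w)
      \<longleftrightarrow> (\<forall>n. \<forall>a>0. kernel_integral f n (complex_of_real a) \<in> \<real>\<^sub>\<ge>\<^sub>0)"
    unfolding cauchy_transform_imaginary_axis
    by (rule weighted_integrable.completely_monotonic_iff_kernel_integral[OF f])
  have "(\<exists>w. (\<forall>y<0. - cauchy_transform f (\<i> * complex_of_real y) = complex_of_real (w y))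
          \<and> absolutely_monotonic_on {..<0} w)
      \<longleftrightarrow> (\<exists>w. (\<forall>y>0. kernel_integral (\<lambda>t. f (- t)) 0 (complex_of_real y) = complex_of_real (w y))
          \<and> completely_monotonic_on {0<..} w)" (is "?L \<longleftrightarrow> ?R")
  proof
    assume ?L
    then obtain w where w: "\<And>y. y < 0 \<Longrightarrow> - cauchy_transform f (\<i> * complex_of_real y) = complex_of_real (w y)"
      and "absolutely_monotonic_on {..<0} w" by blast
    moreover have "kernel_integral (\<lambda>t. f (- t)) 0 (complex_of_real y) = complex_of_real (w (- y))" if "y > 0" for y
      using w[of "- y"] that unfolding minus_cauchy_transform_imaginary_axis by simp
    ultimately show ?R
      by (intro exI[of _ "\<lambda>y. w (- y)"]) (simp add: absolutely_monotonic_reflect)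
  next
    assume ?R
    then obtain w where w: "\<And>y. y > 0 \<Longrightarrow> kernel_integral (\<lambda>t. f (- t)) 0 (complex_of_real y) = complex_of_real (w y)"
      and "completely_monotonic_on {0<..} w" by blast
    moreover have "- cauchy_transform f (\<i> * complex_of_real y) = complex_of_real (w (- y))" if "y < 0" for y
      using w[of "- y"] that unfolding minus_cauchy_transform_imaginary_axis by simp
    ultimately show ?L
      by (intro exI[of _ "\<lambda>y. w (- y)"]) (simp add: absolutely_monotonic_reflect)
  qed
  also have "\<dots> \<longleftrightarrow> (\<forall>n. \<forall>a>0. kernel_integral (\<lambda>t. f (- t)) n (complex_of_real a) \<in> \<real>\<^sub>\<ge>\<^sub>0)"
    by (rule weighted_integrable.completely_monotonic_iff_kernel_integral[OF f'])
  finally have neg: "?L \<longleftrightarrow> (\<forall>n. \<forall>a>0. kernel_integral (\<lambda>t. f (- t)) n (complex_of_real a) \<in> \<real>\<^sub>\<ge>\<^sub>0)" .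
  show ?thesis
    unfolding pos neg
  proof
    assume "is_char_fun f"
    then obtain M where M: "real_distribution M" "\<And>t. f t = char M t"
      by (auto simp: is_char_fun_def)
    have M': "real_distribution (distr M borel uminus)" "\<And>t. f (- t) = char (distr M borel uminus) t"
      using char_distr_uminus[OF M(1)] M(2) by simp_all
    show "(\<forall>n. \<forall>a>0. kernel_integral f n (complex_of_real a) \<in> \<real>\<^sub>\<ge>\<^sub>0) \<and>
        (\<forall>n. \<forall>a>0. kernel_integral (\<lambda>t. f (- t)) n (complex_of_real a) \<in> \<real>\<^sub>\<ge>\<^sub>0)"
      using weighted_integrable.kernel_integral_nonneg_of_char[OF f M]
        weighted_integrable.kernel_integral_nonneg_of_char[OF f' M'] by blast
  next
    assume "(\<forall>n. \<forall>a>0. kernel_integral f n (complex_of_real a) \<in> \<real>\<^sub>\<ge>\<^sub>0) \<and>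
        (\<forall>n. \<forall>a>0. kernel_integral (\<lambda>t. f (- t)) n (complex_of_real a) \<in> \<real>\<^sub>\<ge>\<^sub>0)"
    thus "is_char_fun f"
      using assms(1-3) f
      by (intro weighted_integrable.is_char_fun_of_kernel_integral_nonneg)
         (auto simp: continuous_on_eq_continuous_at)
  qed
qed

end
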